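(* Suppose that $0\le \delta_k\le 1$ for all $k=1,\dots,r$, and let $\pi:[r]\to[r]$ be any permutation. Then the degree vector $m^{\pi}\in\mathbb{Z}^r$ given by $$m_k^{\pi}=\Bigl(-\delta_k+\sum_{j:\,\pi(j)\ge\pi(k)} l_j\Bigr)d_k-l_k,\qquad k=1,\dots,r,$$ is determinantal, i.e. it defines a determinantal (Weyman) complex.
   Context: Let $r\ge 1$ and let $l=(l_1,\dots,l_r)$, $d=(d_1,\dots,d_r)$ be vectors of positive integers; put $n=\sum_{k=1}^r l_k$ and $[r]=\{1,\dots,r\}$. Let $X=\mathbb{P}^{l_1}\times\cdots\times\mathbb{P}^{l_r}$ over an algebraically closed field of characteristic zero. For $a\in\mathbb{Z}^r$, $H^q(X,a)$ denotes the $q$-th cohomology of the sheaf $\mathcal{O}_X(a_1,\dots,a_r)$, and $H^j(\mathbb{P}^{l_k},a_k)$ is the cohomology of $\mathcal{O}(a_k)$ on $\mathbb{P}^{l_k}$. By the Künneth and Bott formulae, $H^q(X,a)=\bigoplus\bigotimes_{k}H^{j_k}(\mathbb{P}^{l_k},a_k)$ (sum over $j_k\in\{0,l_k\}$ with $\sum_k j_k=q$), where $H^0(\mathbb{P}^{l_k},a_k)\ne0\iff a_k\ge0$ and $H^{l_k}(\mathbb{P}^{l_k},a_k)\neq0\iff a_k<-l_k$. For a degree vector $m\in\mathbb{Z}^r$ and $\nu\in\mathbb{Z}$, the $\nu$-th term of the Weyman complex is $K_\nu(m)=\bigoplus_{p=0}^{n+1}H^{p-\nu}(X,m-pd)^{\binom{n+1}{p}}$.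 The vector $m$ (and its Weyman complex) is called determinantal if the complex has just the two terms $K_1(m)\to K_0(m)$, i.e. $K_\nu(m)=0$ for all $\nu\notin\{0,1\}$; by a result of Weyman and Zelevinsky this is equivalent to $K_{-1}(m)=K_2(m)=0$. The defect vector $\delta\in\mathbb{Z}^r$ is $\delta_k=l_k-\lceil l_k/d_k\rceil$. *)

theory Defs
  imports
    Complex_Main
    "HOL-Algebra.Product_Groups"
    "HOL-Library.Poly_Mapping"
    "HOL-Combinatorics.Permutations"
    "HOL-Computational_Algebra.Polynomial"
begin

text \<open>
  Sheaf cohomology of the line bundles \<open>O(a\<^sub>1, \<dots>, a\<^sub>r)\<close> on
  \<open>X = P\<^bsup>l 1\<^esup> \<times> \<dots> \<times> P\<^bsup>l r\<^esup>\<close> over a field \<open>'k\<close> is Cech cohomology with respect to the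
  standard affine open cover of \<open>X\<close>. The variety \<open>X\<close> is separated and line bundles are
  quasi-coherent, so this is the usual sheaf cohomology. Vectors indexed by \<open>[r]\<close> are functions
  on \<open>nat\<close> of which only the values on \<open>{1..r}\<close> are used.

  The Cox ring of \<open>X\<close> is the polynomial ring in the variables \<open>x\<^bsub>k,i\<^esub>\<close> with \<open>k \<in> {1..r}\<close>
  and \<open>i \<le> l k\<close>, graded by \<open>\<int>\<^sup>r\<close>. It lies in the Laurent polynomial ring, whose elements are
  finitely supported functions on the group of exponent vectors.
\<close>

type_synonym 'k laurent = "((nat \<times> nat) \<Rightarrow>\<^sub>0 int) \<Rightarrow>\<^sub>0 'k"

definition coords :: "nat \<Rightarrow> (nat \<Rightarrow> nat) \<Rightarrow> (nat \<times> nat) set" where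
  "coords r l = (SIGMA k : {1..r}. {..l k})"

text \<open>
  The degree \<open>a\<close> part of the localization of the Cox ring at the variables in \<open>V\<close>. If \<open>V\<close>
  contains a variable of each factor, these are the sections of \<open>O(a)\<close> over the affine open set
  where no variable in \<open>V\<close> vanishes.
\<close>

definition twist_sections ::
    "nat \<Rightarrow> (nat \<Rightarrow> nat) \<Rightarrow> (nat \<Rightarrow> int) \<Rightarrow> (nat \<times> nat) set \<Rightarrow> 'k::field laurent set" where
  "twist_sections r l a V =
    {f. \<forall>e \<in> Poly_Mapping.keys f.
          Poly_Mapping.keys e \<subseteq> coords r l \<and>
          (\<forall>v. v \<notin> V \<longrightarrow> 0 \<le> Poly_Mapping.lookup e v) \<and>
          (\<forall>k \<in> {1..r}. (\<Sum>i\<le>l k. Poly_Mapping.lookup e (k, i)) = a k)}"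

text \<open>
  A chart \<open>\<sigma>\<close> picks one homogeneous coordinate in each factor. It stands for the affine open set
  on which the coordinates \<open>x\<^bsub>k,\<sigma> k\<^esub>\<close> are nonzero. These sets cover \<open>X\<close>.
\<close>

definition charts :: "nat \<Rightarrow> (nat \<Rightarrow> nat) \<Rightarrow> (nat \<Rightarrow> nat) set" where
  "charts r l = (\<Pi>\<^sub>E k \<in> {1..r}. {..l k})"

definition inverted :: "nat \<Rightarrow> (nat \<Rightarrow> nat) list \<Rightarrow> (nat \<times> nat) set" where
  "inverted r s = {(k, \<sigma> k) | k \<sigma>. k \<in> {1..r} \<and> \<sigma> \<in> set s}"

text \<open>
  Cochains of degree \<open>q\<close> are families of sections over the intersections of \<open>q + 1\<close> charts, indexed
  by all \<open>(q + 1)\<close>-tuples (repetitions allowed), and extended by zero to all other lists. The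
  complex is indexed by integers. It is zero in negative degrees because the empty tuple is
  excluded.
\<close>

definition chart_tuples :: "nat \<Rightarrow> (nat \<Rightarrow> nat) \<Rightarrow> int \<Rightarrow> (nat \<Rightarrow> nat) list set" where
  "chart_tuples r l q = {s. s \<noteq> [] \<and> int (length s) = q + 1 \<and> set s \<subseteq> charts r l}"

definition cech_cochains ::
    "nat \<Rightarrow> (nat \<Rightarrow> nat) \<Rightarrow> (nat \<Rightarrow> int) \<Rightarrow> int \<Rightarrow> ((nat \<Rightarrow> nat) list \<Rightarrow> 'k::field laurent) monoid"
  where
  "cech_cochains r l a q =
    \<lparr>carrier = {c. (\<forall>s \<in> chart_tuples r l q. c s \<in> twist_sections r l a (inverted r s)) \<and>
                   (\<forall>s. s \<notin> chart_tuples r l q \<longrightarrow> c s = 0)},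
     monoid.mult = (\<lambda>c c' s. c s + c' s),
     one = (\<lambda>s. 0)\<rparr>"

text \<open>Restriction of sections to a smaller intersection is the inclusion of Laurent polynomials.\<close>

definition cech_diff ::
    "nat \<Rightarrow> (nat \<Rightarrow> nat) \<Rightarrow> int \<Rightarrow> ((nat \<Rightarrow> nat) list \<Rightarrow> 'k::field laurent)
      \<Rightarrow> (nat \<Rightarrow> nat) list \<Rightarrow> 'k laurent" where
  "cech_diff r l q c =
    (\<lambda>s. if s \<in> chart_tuples r l (q + 1)
         then \<Sum>j<length s. (- 1) ^ j * c (take j s @ drop (Suc j) s)
         else 0)"

text \<open>The additive group of \<open>H\<^sup>q(X, a)\<close>.\<close>

definition cohomology ::
    "nat \<Rightarrow> (nat \<Rightarrow> nat) \<Rightarrow> (nat \<Rightarrow> int) \<Rightarrow> int \<Rightarrow> ((nat \<Rightarrow> nat) list \<Rightarrow> 'k::field laurent) set monoid"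
  where
  "cohomology r l a q =
    (cech_cochains r l a q)
      \<lparr>carrier := kernel (cech_cochains r l a q) (cech_cochains r l a (q + 1)) (cech_diff r l q)\<rparr>
    Mod (cech_diff r l (q - 1) ` carrier (cech_cochains r l a (q - 1)))"

text \<open>
  The term \<open>K\<^sub>\<nu>(m)\<close> of the Weyman complex. The product is finite, hence a direct sum. The pairs
  \<open>(p, i)\<close> enumerate the \<open>n + 1\<close> choose \<open>p\<close> copies of each summand.
\<close>

definition weyman_term ::
    "nat \<Rightarrow> (nat \<Rightarrow> nat) \<Rightarrow> (nat \<Rightarrow> nat) \<Rightarrow> (nat \<Rightarrow> int) \<Rightarrow> int
      \<Rightarrow> (nat \<times> nat \<Rightarrow> ((nat \<Rightarrow> nat) list \<Rightarrow> 'k::field laurent) set) monoid" where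
  "weyman_term r l d m \<nu> =
    (let n = (\<Sum>k = 1..r. l k) in
      product_group (SIGMA p : {0..n + 1}. {..<(n + 1) choose p})
        (\<lambda>(p, i). cohomology r l (\<lambda>k. m k - int p * int (d k)) (int p - \<nu>)))"

definition determinantal ::
    "'k::field itself \<Rightarrow> nat \<Rightarrow> (nat \<Rightarrow> nat) \<Rightarrow> (nat \<Rightarrow> nat) \<Rightarrow> (nat \<Rightarrow> int) \<Rightarrow> bool" where
  "determinantal K r l d m \<longleftrightarrow>
    (\<forall>\<nu>. \<nu> \<notin> {0, 1} \<longrightarrow>
      trivial_group (weyman_term r l d m \<nu> ::
        (nat \<times> nat \<Rightarrow> ((nat \<Rightarrow> nat) list \<Rightarrow> 'k laurent) set) monoid))"

definition defect :: "(nat \<Rightarrow> nat) \<Rightarrow> (nat \<Rightarrow> nat) \<Rightarrow> nat \<Rightarrow> int" where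
  "defect l d k = int (l k) - \<lceil>real (l k) / real (d k)\<rceil>"

end

theory Submission
  imports Defs
begin

text \<open>
  The Cech complex splits by exponents \<open>e\<close> of Laurent monomials. The part at \<open>e\<close> consists of the
  cochains on the tuples of charts that together use every coordinate with negative exponent in \<open>e\<close>.
  Let \<open>N k\<close> be the set of these coordinates in factor \<open>k\<close>. If no \<open>N k\<close> is the full set of
  coordinates, some chart avoids all of them and serves as a cone point; otherwise one removes a
  coordinate from a full factor and uses the long exact sequence. Hence cohomology lives only at
  exponents with every \<open>N k\<close> empty or full, in degree \<open>\<Sum>k\<in>J. l k\<close>, where \<open>J\<close> is the set of full
  factors; this is the vanishing part of the Kuenneth and Bott formulae.

  For the vector of the theorem, the defect bound forces \<open>J\<close> to be closed upwards for \<open>\<pi>\<close>.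
  With \<open>q\<close> the sum of \<open>l\<close> over \<open>J\<close>, the least element of \<open>J\<close> gives \<open>q \<le> p\<close> and the greatest
  element outside \<open>J\<close> gives \<open>p \<le> q\<close>. Only when \<open>J\<close> is everything can \<open>p = q + 1\<close> occur.
\<close>


section \<open>The alternating-face differential on tuples\<close>

definition tuple_diff :: "('v list \<Rightarrow> 'c::ring_1) \<Rightarrow> 'v list \<Rightarrow> 'c" where
  "tuple_diff f s = (\<Sum>j<length s. (- 1) ^ j * f (take j s @ drop (Suc j) s))"

lemma tuple_diff_Nil [simp]: "tuple_diff f [] = 0"
  by (simp add: tuple_diff_def)

text \<open>Face 0 drops \<open>x\<close>; every other face keeps \<open>x\<close> in front and
  changes sign. Later arguments recurse on this instead of reindexing sums.\<close>

lemma tuple_diff_Cons: "tuple_diff f (x # s) = f s - tuple_diff (\<lambda>t. f (x # t)) s"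
  by (simp add: tuple_diff_def sum.lessThan_Suc_shift sum_negf del: sum.lessThan_Suc)

lemma tuple_diff_minus: "tuple_diff (\<lambda>t. f t - g t) s = tuple_diff f s - tuple_diff g s"
  by (simp add: tuple_diff_def right_diff_distrib sum_subtractf)

lemma tuple_diff_add: "tuple_diff (\<lambda>t. f t + g t) s = tuple_diff f s + tuple_diff g s"
  by (simp add: tuple_diff_def distrib_left sum.distrib)

lemma tuple_diff_zero: "tuple_diff (\<lambda>t. 0) s = 0"
  by (simp add: tuple_diff_def)

lemma tuple_diff_cong:
  assumes "\<And>t. Suc (length t) = length s \<Longrightarrow> set t \<subseteq> set s \<Longrightarrow> f t = g t"
  shows "tuple_diff f s = tuple_diff g s"
  unfolding tuple_diff_def
proof (rule sum.cong[OF refl])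
  fix j assume "j \<in> {..<length s}"
  then have "f (take j s @ drop (Suc j) s) = g (take j s @ drop (Suc j) s)"
    by (intro assms) (auto dest: in_set_takeD in_set_dropD)
  then show "(- 1) ^ j * f (take j s @ drop (Suc j) s) = (- 1) ^ j * g (take j s @ drop (Suc j) s)"
    by simp
qed

text \<open>By the recursion, both terms of the double differential at \<open>x # s\<close> equal
  \<open>tuple_diff f s\<close>. The induction hypothesis is applied to
  \<open>\<lambda>t. f (x # t)\<close>, so \<open>f\<close> is generalised.\<close>

lemma tuple_diff_tuple_diff: "tuple_diff (tuple_diff f) s = 0"
proof (induction s arbitrary: f)
  case (Cons x s)
  have "tuple_diff (\<lambda>t. tuple_diff f (x # t)) s = tuple_diff f s"
    by (simp add: tuple_diff_Cons tuple_diff_minus Cons.IH)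
  then show ?case
    by (simp add: tuple_diff_Cons[of "tuple_diff f"])
qed simp

section \<open>Cochains on covering tuples and their acyclicity\<close>

text \<open>Non-covering tuples are closed under faces, so cochains on covering tuples form a
  relative complex. The empty tuple is excluded because it would cover when all \<open>N k\<close>
  are empty and augment the complex.\<close>

definition covering_tuples ::
    "'a set \<Rightarrow> ('a \<Rightarrow> 'b set) \<Rightarrow> ('a \<Rightarrow> 'b set) \<Rightarrow> nat \<Rightarrow> ('a \<Rightarrow> 'b) list set" where
  "covering_tuples K A N n =
    {s. s \<noteq> [] \<and> length s = n \<and> set s \<subseteq> Pi\<^sub>E K A \<and> (\<forall>k\<in>K. N k \<subseteq> (\<lambda>\<sigma>. \<sigma> k) ` set s)}"

definition cochains ::
    "'a set \<Rightarrow> ('a \<Rightarrow> 'b set) \<Rightarrow> ('a \<Rightarrow> 'b set) \<Rightarrow> nat \<Rightarrow> (('a \<Rightarrow> 'b) list \<Rightarrow> 'c::ring_1) set" where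
  "cochains K A N n = {f. \<forall>s. s \<notin> covering_tuples K A N n \<longrightarrow> f s = 0}"

text \<open>Cochains are indexed by the length of the tuples, cocycles and coboundaries by the degree,
  which is smaller by one.\<close>

definition cocycles ::
    "'a set \<Rightarrow> ('a \<Rightarrow> 'b set) \<Rightarrow> ('a \<Rightarrow> 'b set) \<Rightarrow> nat \<Rightarrow> (('a \<Rightarrow> 'b) list \<Rightarrow> 'c::ring_1) set" where
  "cocycles K A N q = {f \<in> cochains K A N (Suc q).
    \<forall>s \<in> covering_tuples K A N (Suc (Suc q)). tuple_diff f s = 0}"

definition coboundaries ::
    "'a set \<Rightarrow> ('a \<Rightarrow> 'b set) \<Rightarrow> ('a \<Rightarrow> 'b set) \<Rightarrow> nat \<Rightarrow> (('a \<Rightarrow> 'b) list \<Rightarrow> 'c::ring_1) set" where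
  "coboundaries K A N q = {f \<in> cochains K A N (Suc q).
    \<exists>g \<in> cochains K A N q. \<forall>s \<in> covering_tuples K A N (Suc q). f s = tuple_diff g s}"

lemma coboundariesI:
  assumes "f \<in> cochains K A N (Suc q)" "g \<in> cochains K A N q"
    "\<And>s. s \<in> covering_tuples K A N (Suc q) \<Longrightarrow> f s = tuple_diff g s"
  shows "f \<in> coboundaries K A N q"
  using assms by (auto simp: coboundaries_def)

text \<open>Dropping an entry cannot help to cover \<open>N\<close>, so all faces of
  \<open>s\<close> are non-covering as well. Hence extension by zero is compatible with the
  differential.\<close>

lemma tuple_diff_not_covering:
  assumes f: "f \<in> cochains K A N n" and s: "\<not> (\<forall>k\<in>K. N k \<subseteq> (\<lambda>\<sigma>. \<sigma> k) ` set s)"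
  shows "tuple_diff f s = 0"
proof -
  have "tuple_diff f s = tuple_diff (\<lambda>t. 0) s"
  proof (rule tuple_diff_cong)
    fix t assume "set t \<subseteq> set s"
    then have "t \<notin> covering_tuples K A N n"
      using s by (force simp: covering_tuples_def)
    then show "f t = 0"
      using f by (simp add: cochains_def)
  qed
  then show ?thesis
    by (simp add: tuple_diff_zero)
qed

text \<open>A vertex \<open>\<tau>\<close> avoiding \<open>N\<close> does not help to cover \<open>N\<close>, so prepending \<open>\<tau>\<close> is a contraction.\<close>

lemma cocycles_subset_coboundaries_cone:
  assumes \<tau>: "\<tau> \<in> Pi\<^sub>E K A" "\<forall>k\<in>K. \<tau> k \<notin> N k"
    and q: "q \<noteq> 0 \<or> (\<exists>k\<in>K. N k \<noteq> {})"
  shows "cocycles K A N q \<subseteq> coboundaries K A N q"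
proof
  fix f assume "f \<in> cocycles K A N q"
  then have f: "f \<in> cochains K A N (Suc q)"
    and f0: "\<And>s. s \<in> covering_tuples K A N (Suc (Suc q)) \<Longrightarrow> tuple_diff f s = 0"
    by (auto simp: cocycles_def)
  have "(\<lambda>t. f (\<tau> # t)) \<in> cochains K A N q"
    unfolding cochains_def
  proof (intro CollectI allI impI)
    fix t assume t: "t \<notin> covering_tuples K A N q"
    have "\<tau> # t \<notin> covering_tuples K A N (Suc q)"
    proof
      assume *: "\<tau> # t \<in> covering_tuples K A N (Suc q)"
      have cov: "N k \<subseteq> (\<lambda>\<sigma>. \<sigma> k) ` set t" if "k \<in> K" for k
        using * \<tau>(2) that by (fastforce simp: covering_tuples_def)
      \<comment> \<open>An empty \<open>t\<close> forces \<open>q = 0\<close>, and by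
        \<open>cov\<close> every \<open>N k\<close> is then empty, against \<open>q\<close>.\<close>
      with * q have "t \<noteq> []"
        by (auto simp: covering_tuples_def)
      with * cov t show False
        by (auto simp: covering_tuples_def)
    qed
    then show "f (\<tau> # t) = 0"
      using f by (simp add: cochains_def)
  qed
  moreover have "f s = tuple_diff (\<lambda>t. f (\<tau> # t)) s" if "s \<in> covering_tuples K A N (Suc q)" for s
  proof -
    have "\<tau> # s \<in> covering_tuples K A N (Suc (Suc q))"
      using that \<tau> by (auto simp: covering_tuples_def)
    from f0[OF this] show ?thesis
      by (simp add: tuple_diff_Cons)
  qed
  ultimately show "f \<in> coboundaries K A N q"
    using f by (intro coboundariesI)
qed

text \<open>
  Tuples covering \<open>N - {v}\<close> either cover \<open>N\<close>, or avoid \<open>v\<close>. This gives a short exact sequence of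
  complexes, and the lemma is the resulting vanishing in its long exact sequence.
\<close>

lemma cocycles_subset_coboundaries_remove:
  fixes A N :: "'a \<Rightarrow> 'b set"
  assumes v: "k \<in> K" "i \<in> N k"
    and N': "N' = N(k := N k - {i})"
    and A': "A' = A(k := A k - {i})"
    and big: "(cocycles K A N' q :: (('a \<Rightarrow> 'b) list \<Rightarrow> 'c::ring_1) set) \<subseteq> coboundaries K A N' q"
    and small: "\<And>p. q = Suc p \<Longrightarrow>
      (cocycles K A' N' p :: (('a \<Rightarrow> 'b) list \<Rightarrow> 'c) set) \<subseteq> coboundaries K A' N' p"
  shows "(cocycles K A N q :: (('a \<Rightarrow> 'b) list \<Rightarrow> 'c) set) \<subseteq> coboundaries K A N q"
proof
  fix f :: "('a \<Rightarrow> 'b) list \<Rightarrow> 'c"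
  assume "f \<in> cocycles K A N q"
  then have f: "f \<in> cochains K A N (Suc q)"
    and f0: "\<And>s. s \<in> covering_tuples K A N (Suc (Suc q)) \<Longrightarrow> tuple_diff f s = 0"
    by (auto simp: cocycles_def)
  have N'_N: "N' k' \<subseteq> N k'" for k'
    by (auto simp: N')
  have sub: "covering_tuples K A N n \<subseteq> covering_tuples K A N' n" for n
    using N'_N by (fastforce simp: covering_tuples_def)
  have f': "f \<in> cochains K A N' (Suc q)"
    using f sub by (auto simp: cochains_def)
  \<comment> \<open>Only \<open>i\<close> in factor \<open>k\<close> can be missing from the cover,
    so all charts in \<open>s\<close> avoid it and lie over \<open>A'\<close>.\<close>
  have split: "s \<in> covering_tuples K A' N' n"
    if "s \<in> covering_tuples K A N' n" "s \<notin> covering_tuples K A N n" for s n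
  proof -
    have cov: "N' k' \<subseteq> (\<lambda>\<sigma>. \<sigma> k') ` set s" if "k' \<in> K" for k'
      using \<open>s \<in> covering_tuples K A N' n\<close> that by (auto simp: covering_tuples_def)
    have "i \<notin> (\<lambda>\<sigma>. \<sigma> k) ` set s"
    proof
      assume i: "i \<in> (\<lambda>\<sigma>. \<sigma> k) ` set s"
      have "N k' \<subseteq> (\<lambda>\<sigma>. \<sigma> k') ` set s" if "k' \<in> K" for k'
        using cov[OF that] i by (cases "k' = k") (auto simp: N')
      then show False
        using that by (simp add: covering_tuples_def)
    qed
    then show ?thesis
      using that(1) by (fastforce simp: covering_tuples_def A' PiE_iff)
  qed
  have A'D: "s \<in> covering_tuples K A N' n" "s \<notin> covering_tuples K A N m"
    if "s \<in> covering_tuples K A' N' n" for s n m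
  proof -
    have *: "Pi\<^sub>E K A' \<subseteq> Pi\<^sub>E K A"
      by (rule PiE_mono) (auto simp: A')
    show "s \<in> covering_tuples K A N' n"
      using that * by (auto simp: covering_tuples_def)
    have "i \<notin> (\<lambda>\<sigma>. \<sigma> k) ` set s"
    proof
      assume "i \<in> (\<lambda>\<sigma>. \<sigma> k) ` set s"
      then obtain \<sigma> where "\<sigma> \<in> set s" "\<sigma> k = i" by auto
      moreover have "\<sigma> \<in> Pi\<^sub>E K A'"
        using that \<open>\<sigma> \<in> set s\<close> by (auto simp: covering_tuples_def)
      then have "\<sigma> k \<in> A' k"
        using v by (auto simp: PiE_iff)
      ultimately show False by (simp add: A')
    qed
    then show "s \<notin> covering_tuples K A N m"
      using v by (auto simp: covering_tuples_def)
  qed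
  \<comment> \<open>Passing from \<open>N\<close> to \<open>N'\<close> adds tuples that do not cover
    \<open>N\<close>; there the differential of \<open>f\<close> vanishes, so \<open>f\<close> stays
    a cocycle.\<close>
  have "tuple_diff f s = 0" if "s \<in> covering_tuples K A N' (Suc (Suc q))" for s
  proof (cases "s \<in> covering_tuples K A N (Suc (Suc q))")
    case False
    with that show ?thesis
      by (intro tuple_diff_not_covering[OF f]) (auto simp: covering_tuples_def)
  qed (rule f0)
  with f' have "f \<in> cocycles K A N' q"
    by (auto simp: cocycles_def)
  then obtain b where b: "b \<in> cochains K A N' q"
    and fb: "\<And>s. s \<in> covering_tuples K A N' (Suc q) \<Longrightarrow> f s = tuple_diff b s"
    using big by (fastforce simp: coboundaries_def)
  show "f \<in> coboundaries K A N q"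
  proof (cases q)
    case 0
    \<comment> \<open>No covering tuple has length 0, so the primitive vanishes and so does
      \<open>f\<close>.\<close>
    then have "b = (\<lambda>s. 0)"
      using b by (auto simp: cochains_def covering_tuples_def)
    then have "\<And>s. s \<in> covering_tuples K A N (Suc q) \<Longrightarrow> f s = tuple_diff (\<lambda>s. 0) s"
      using fb sub by blast
    then show ?thesis
      using f by (intro coboundariesI[of _ _ _ _ _ "\<lambda>s. 0"]) (auto simp: cochains_def)
  next
    case (Suc p)
    \<comment> \<open>The part of \<open>b\<close> on tuples avoiding \<open>i\<close> is what keeps
      \<open>b\<close> from being a cochain for \<open>N\<close>. Its differential is
      \<open>f\<close> on such tuples, hence zero, so it has a primitive \<open>e\<close> one degree
      lower.\<close>
    define b' where "b' s = (if s \<in> covering_tuples K A' N' q then b s else 0)" for s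
    have "b' \<in> cochains K A' N' (Suc p)"
      by (auto simp: cochains_def b'_def Suc)
    moreover have "tuple_diff b' s = 0" if s: "s \<in> covering_tuples K A' N' (Suc (Suc p))" for s
    proof -
      have "tuple_diff b' s = tuple_diff b s"
      proof (rule tuple_diff_cong)
        fix t assume t: "Suc (length t) = length s" "set t \<subseteq> set s"
        show "b' t = b t"
        proof (cases "t \<in> covering_tuples K A' N' q")
          case False
          with s t have "t \<notin> covering_tuples K A N' q"
            by (auto simp: covering_tuples_def Suc)
          then show ?thesis
            using b False by (auto simp: cochains_def b'_def)
        qed (simp add: b'_def)
      qed
      also have "\<dots> = f s"
        using fb A'D(1)[OF s] by (simp add: Suc)
      also have "f s = 0"
        using f A'D(2)[OF s] by (auto simp: cochains_def)
      finally show ?thesis .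
    qed
    ultimately have "b' \<in> cocycles K A' N' p"
      by (auto simp: cocycles_def)
    then obtain e where e: "e \<in> cochains K A' N' p"
      and be: "\<And>s. s \<in> covering_tuples K A' N' (Suc p) \<Longrightarrow> b' s = tuple_diff e s"
      using small[OF Suc] by (fastforce simp: coboundaries_def)
    have e': "e \<in> cochains K A N' p"
      using e A'D(1) by (auto simp: cochains_def)
    \<comment> \<open>Subtracting the differential of \<open>e\<close> cancels \<open>b\<close> on
      tuples avoiding \<open>i\<close> without changing the differential of \<open>b\<close>. The
      truncation discards values at tuples with entries outside
      \<open>Pi\<^sub>E K A\<close>.\<close>
    define g where "g s = (if s \<in> covering_tuples K A N' q then b s - tuple_diff e s else 0)" for s
    have "g \<in> cochains K A N q"
      unfolding cochains_def
    proof (intro CollectI allI impI)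
      fix s assume "s \<notin> covering_tuples K A N q"
      then show "g s = 0"
        using split[of s q] be[of s] by (auto simp: g_def b'_def Suc)
    qed
    moreover have "f s = tuple_diff g s" if s: "s \<in> covering_tuples K A N (Suc q)" for s
    proof -
      have "tuple_diff g s = tuple_diff (\<lambda>t. b t - tuple_diff e t) s"
      proof (rule tuple_diff_cong)
        fix t assume t: "Suc (length t) = length s" "set t \<subseteq> set s"
        show "g t = b t - tuple_diff e t"
        proof (cases "t \<in> covering_tuples K A N' q")
          case False
          with s t have "\<not> (\<forall>k\<in>K. N' k \<subseteq> (\<lambda>\<sigma>. \<sigma> k) ` set t)"
            by (auto simp: covering_tuples_def Suc)
          then have "tuple_diff e t = 0"
            by (rule tuple_diff_not_covering[OF e'])
          then show ?thesis
            using b False by (auto simp: cochains_def g_def)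
        qed (simp add: g_def)
      qed
      also have "\<dots> = f s"
        using fb[OF subsetD[OF sub s]] by (simp add: tuple_diff_minus tuple_diff_tuple_diff)
      finally show ?thesis by simp
    qed
    ultimately show ?thesis
      using f by (intro coboundariesI)
  qed
qed

text \<open>The excluded degree is that of the one possible nonzero class. Removing \<open>i\<close>
  from a full factor yields two smaller problems: with \<open>A\<close>, the new \<open>N\<close> is
  exceptional only if the factor is a single point, which adds 0 to the degree; with
  \<open>A'\<close>, the factor remains full and the exceptional degree falls by one, as does
  \<open>q\<close>.\<close>

lemma cocycles_subset_coboundaries:
  fixes A N :: "'a \<Rightarrow> 'b set"
  assumes "finite K" "\<And>k. k \<in> K \<Longrightarrow> finite (A k)" "\<And>k. k \<in> K \<Longrightarrow> N k \<subseteq> A k"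
    and "\<not> ((\<forall>k\<in>K. N k = {} \<or> N k = A k) \<and> q = (\<Sum>k | k \<in> K \<and> N k \<noteq> {}. card (A k) - 1))"
  shows "(cocycles K A N q :: (('a \<Rightarrow> 'b) list \<Rightarrow> 'c::ring_1) set) \<subseteq> coboundaries K A N q"
  using assms
proof (induction "\<Sum>k\<in>K. card (N k)" arbitrary: A N q rule: less_induct)
  case less
  show ?case
  \<comment> \<open>An empty factor leaves no charts. Afterwards a full \<open>N k\<close> always
    has an element to remove.\<close>
  proof (cases "\<exists>k\<in>K. A k = {}")
    case True
    then have "Pi\<^sub>E K A = {}"
      by (simp add: PiE_eq_empty_iff)
    then have "covering_tuples K A N n = {}" for n
      by (auto simp: covering_tuples_def)
    then show ?thesis
      by (auto simp: cocycles_def coboundaries_def cochains_def)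
  next
    case A: False
    show ?thesis
    proof (cases "\<exists>k\<in>K. N k = A k")
      case False
      with less.prems(3) have "\<forall>k\<in>K. \<exists>x. x \<in> A k - N k"
        by blast
      then obtain \<tau> where \<tau>: "\<forall>k\<in>K. \<tau> k \<in> A k - N k"
        by metis
      have "restrict \<tau> K \<in> Pi\<^sub>E K A" "\<forall>k\<in>K. restrict \<tau> K k \<notin> N k"
        using \<tau> by auto
      \<comment> \<open>Degree 0 with every \<open>N k\<close> empty is the exceptional case with
        empty sum.\<close>
      moreover have "q \<noteq> 0 \<or> (\<exists>k\<in>K. N k \<noteq> {})"
      proof (rule ccontr)
        assume *: "\<not> ?thesis"
        then have "{k \<in> K. N k \<noteq> {}} = {}" by blast
        then show False
          using less.prems(4) * by (simp del: Collect_empty_eq)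
      qed
      ultimately show ?thesis
        by (rule cocycles_subset_coboundaries_cone)
    next
      case True
      then obtain k where k: "k \<in> K" "N k = A k" by blast
      with A obtain i where i: "i \<in> N k" by blast
      define N' where "N' = N(k := N k - {i})"
      define A' where "A' = A(k := A k - {i})"
      have fin: "finite (N k')" if "k' \<in> K" for k'
        using less.prems that by (meson finite_subset)
      have lt: "(\<Sum>k\<in>K. card (N' k)) < (\<Sum>k\<in>K. card (N k))"
      proof (rule sum_strict_mono_ex1[OF less.prems(1)])
        show "\<forall>x\<in>K. card (N' x) \<le> card (N x)"
          using fin by (auto simp: N'_def intro!: card_mono)
        show "\<exists>x\<in>K. card (N' x) < card (N x)"
          using card_Diff1_less[OF fin[OF k(1)] i] k
          by (intro bexI[of _ k]) (simp_all add: N'_def del: card_Diff_singleton)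
      qed
      define S where "S = {j \<in> K - {k}. N j \<noteq> {}}"
      have S: "finite S" "k \<notin> S"
        using less.prems(1) by (auto simp: S_def)
      have SN: "{j \<in> K. N j \<noteq> {}} = insert k S"
        using k i by (auto simp: S_def)
      \<comment> \<open>The full factor \<open>k\<close> contributes \<open>card (A k) - 1\<close>;
        splitting it off allows comparison with both smaller problems.\<close>
      have bad: "\<not> ((\<forall>j\<in>K - {k}. N j = {} \<or> N j = A j) \<and>
          q = card (A k) - 1 + (\<Sum>j\<in>S. card (A j) - 1))"
        using less.prems(4) k S unfolding SN by auto
      show ?thesis
      proof (rule cocycles_subset_coboundaries_remove[OF k(1) i N'_def A'_def])
        show "(cocycles K A N' q :: (('a \<Rightarrow> 'b) list \<Rightarrow> 'c) set) \<subseteq> coboundaries K A N' q"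
        proof (rule less.hyps[OF lt less.prems(1,2)])
          show "N' j \<subseteq> A j" if "j \<in> K" for j
            using less.prems(3)[OF that] by (auto simp: N'_def)
          show "\<not> ((\<forall>j\<in>K. N' j = {} \<or> N' j = A j) \<and> q = (\<Sum>j | j \<in> K \<and> N' j \<noteq> {}. card (A j) - 1))"
          proof
            assume *: "(\<forall>j\<in>K. N' j = {} \<or> N' j = A j) \<and>
              q = (\<Sum>j | j \<in> K \<and> N' j \<noteq> {}. card (A j) - 1)"
            then have "N' k = {} \<or> N' k = A k" using k by blast
            \<comment> \<open>\<open>N' k\<close> lacks \<open>i\<close>, so it is not
              \<open>A k\<close> and must be empty.\<close>
            then have Ak: "A k = {i}" "N' k = {}"
              using k i by (auto simp: N'_def)
            then have "{j \<in> K. N' j \<noteq> {}} = S"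
              by (auto simp: S_def N'_def)
            moreover have "\<forall>j\<in>K - {k}. N j = {} \<or> N j = A j"
              using * by (auto simp: N'_def split: if_splits)
            ultimately show False
              using * bad Ak by simp
          qed
        qed
      next
        fix p assume p: "q = Suc p"
        show "(cocycles K A' N' p :: (('a \<Rightarrow> 'b) list \<Rightarrow> 'c) set) \<subseteq> coboundaries K A' N' p"
        proof (cases "A' k = {}")
          case True
          then have "Pi\<^sub>E K A' = {}"
            using k by (auto simp: PiE_eq_empty_iff)
          then have "covering_tuples K A' N' n = {}" for n
            by (auto simp: covering_tuples_def)
          then show ?thesis
            by (auto simp: cocycles_def coboundaries_def cochains_def)
        next
          case A'k: False
          show ?thesis
          proof (rule less.hyps[OF lt less.prems(1)])
            show "finite (A' j)" if "j \<in> K" for j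
              using less.prems(2) that by (auto simp: A'_def)
            show "N' j \<subseteq> A' j" if "j \<in> K" for j
              using less.prems(3)[OF that] by (auto simp: N'_def A'_def)
            show "\<not> ((\<forall>j\<in>K. N' j = {} \<or> N' j = A' j) \<and> p = (\<Sum>j | j \<in> K \<and> N' j \<noteq> {}. card (A' j) - 1))"
            proof
              assume *: "(\<forall>j\<in>K. N' j = {} \<or> N' j = A' j) \<and>
                p = (\<Sum>j | j \<in> K \<and> N' j \<noteq> {}. card (A' j) - 1)"
              have "{j \<in> K. N' j \<noteq> {}} = insert k S"
                using k A'k by (auto simp: S_def N'_def A'_def)
              moreover have "(\<Sum>j\<in>S. card (A' j) - 1) = (\<Sum>j\<in>S. card (A j) - 1)"
                using S by (intro sum.cong) (auto simp: A'_def)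
              ultimately have "p = card (A k) - 1 - 1 + (\<Sum>j\<in>S. card (A j) - 1)"
                using * S k i less.prems(2) by (simp add: A'_def)
              \<comment> \<open>This makes the natural-number subtraction
                \<open>card (A k) - 1 - 1\<close> exact, so that \<open>Suc p\<close> is the degree
                ruled out by \<open>bad\<close>.\<close>
              moreover have "card (A k) - 1 \<noteq> 0"
              proof -
                have "card (A' k) \<noteq> 0"
                  using A'k k less.prems(2)[of k] by (simp add: A'_def)
                then show ?thesis
                  using k i by (simp add: A'_def)
              qed
              moreover have "\<forall>j\<in>K - {k}. N j = {} \<or> N j = A j"
                using * by (auto simp: N'_def A'_def split: if_splits)
              ultimately show False
                using bad p by auto
            qed
          qed
        qed
      qed
    qed
  qed
qed


section \<open>Splitting the Cech complex by monomials\<close>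

definition has_degree ::
    "nat \<Rightarrow> (nat \<Rightarrow> nat) \<Rightarrow> (nat \<Rightarrow> int) \<Rightarrow> ((nat \<times> nat) \<Rightarrow>\<^sub>0 int) \<Rightarrow> bool" where
  "has_degree r l a e \<longleftrightarrow> Poly_Mapping.keys e \<subseteq> coords r l \<and>
    (\<forall>k\<in>{1..r}. (\<Sum>i\<le>l k. Poly_Mapping.lookup e (k, i)) = a k)"

definition neg_support :: "(nat \<Rightarrow> nat) \<Rightarrow> ((nat \<times> nat) \<Rightarrow>\<^sub>0 int) \<Rightarrow> nat \<Rightarrow> nat set" where
  "neg_support l e k = {i. i \<le> l k \<and> Poly_Mapping.lookup e (k, i) < 0}"

abbreviation coord_tuples ::
    "nat \<Rightarrow> (nat \<Rightarrow> nat) \<Rightarrow> (nat \<Rightarrow> nat set) \<Rightarrow> nat \<Rightarrow> (nat \<Rightarrow> nat) list set" where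
  "coord_tuples r l \<equiv> covering_tuples {1..r} (\<lambda>k. {..l k})"

text \<open>Writing degrees as \<open>int n - 1\<close> makes \<open>n\<close> the tuple length. The
  value \<open>n = 0\<close> is the zero group in degree -1, so degree 0 needs no separate
  treatment.\<close>

lemma chart_tuples_eq: "chart_tuples r l (int n - 1) = coord_tuples r l (\<lambda>k. {}) n"
  by (auto simp: chart_tuples_def covering_tuples_def charts_def)

lemma chart_tuples_Suc: "chart_tuples r l (int n) = coord_tuples r l (\<lambda>k. {}) (Suc n)"
  using chart_tuples_eq[of r l "Suc n"] by simp

text \<open>Being a section is a condition on each monomial separately: every variable with negative
  exponent must be inverted. Variables outside \<open>coords\<close> have exponent 0 and impose
  nothing.\<close>

lemma mem_twist_sections_iff:
  "f \<in> twist_sections r l a (inverted r s) \<longleftrightarrow>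
    (\<forall>e. Poly_Mapping.lookup f e \<noteq> 0 \<longrightarrow> has_degree r l a e \<and>
      (\<forall>k\<in>{1..r}. neg_support l e k \<subseteq> (\<lambda>\<sigma>. \<sigma> k) ` set s))"
proof -
  have "(\<forall>v. v \<notin> inverted r s \<longrightarrow> 0 \<le> Poly_Mapping.lookup e v) \<longleftrightarrow>
      (\<forall>k\<in>{1..r}. neg_support l e k \<subseteq> (\<lambda>\<sigma>. \<sigma> k) ` set s)"
    if e: "Poly_Mapping.keys e \<subseteq> coords r l" for e :: "(nat \<times> nat) \<Rightarrow>\<^sub>0 int"
  proof
    assume *: "\<forall>v. v \<notin> inverted r s \<longrightarrow> 0 \<le> Poly_Mapping.lookup e v"
    show "\<forall>k\<in>{1..r}. neg_support l e k \<subseteq> (\<lambda>\<sigma>. \<sigma> k) ` set s"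
    proof (intro ballI subsetI)
      fix k i assume "k \<in> {1..r}" and i: "i \<in> neg_support l e k"
      have "(k, i) \<in> inverted r s"
        using *[rule_format, of "(k, i)"] i by (force simp: neg_support_def)
      then show "i \<in> (\<lambda>\<sigma>. \<sigma> k) ` set s"
        by (auto simp: inverted_def)
    qed
  next
    assume *: "\<forall>k\<in>{1..r}. neg_support l e k \<subseteq> (\<lambda>\<sigma>. \<sigma> k) ` set s"
    show "\<forall>v. v \<notin> inverted r s \<longrightarrow> 0 \<le> Poly_Mapping.lookup e v"
    proof (intro allI impI)
      fix v assume v: "v \<notin> inverted r s"
      show "0 \<le> Poly_Mapping.lookup e v"
      proof (cases "v \<in> Poly_Mapping.keys e")
        case True
        with e obtain k i where ki: "v = (k, i)" "k \<in> {1..r}" "i \<le> l k"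
          by (auto simp: coords_def)
        then have "i \<notin> (\<lambda>\<sigma>. \<sigma> k) ` set s"
          using v by (auto simp: inverted_def)
        then have "i \<notin> neg_support l e k"
          using * ki by blast
        then show ?thesis
          using ki by (simp add: neg_support_def)
      qed (simp add: in_keys_iff)
    qed
  qed
  then have "(Poly_Mapping.keys e \<subseteq> coords r l \<and> (\<forall>v. v \<notin> inverted r s \<longrightarrow> 0 \<le> Poly_Mapping.lookup e v) \<and>
      (\<forall>k\<in>{1..r}. (\<Sum>i\<le>l k. Poly_Mapping.lookup e (k, i)) = a k)) \<longleftrightarrow>
      has_degree r l a e \<and> (\<forall>k\<in>{1..r}. neg_support l e k \<subseteq> (\<lambda>\<sigma>. \<sigma> k) ` set s)" for e
    unfolding has_degree_def by (cases "Poly_Mapping.keys e \<subseteq> coords r l") (simp_all only: simp_thms conj_commute)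
  then show ?thesis
    by (simp only: twist_sections_def mem_Collect_eq Ball_def[of "Poly_Mapping.keys f"] in_keys_iff)
qed

text \<open>
  The Cech complex is the direct sum, over the exponents \<open>e\<close> of degree \<open>a\<close>, of the complexes of
  cochains on the tuples of charts that invert all variables with negative exponent in \<open>e\<close>.
\<close>

lemma mem_cech_cochains_iff:
  fixes c :: "(nat \<Rightarrow> nat) list \<Rightarrow> 'k::field laurent"
  shows "c \<in> carrier (cech_cochains r l a (int n - 1)) \<longleftrightarrow>
    (\<forall>e. if has_degree r l a e
      then (\<lambda>s. Poly_Mapping.lookup (c s) e) \<in> cochains {1..r} (\<lambda>k. {..l k}) (neg_support l e) n
      else \<forall>s. Poly_Mapping.lookup (c s) e = 0)"
  (is "_ = (\<forall>e. ?P e)")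
proof -
  have cov: "coord_tuples r l (neg_support l e) n =
      {s \<in> coord_tuples r l (\<lambda>k. {}) n. \<forall>k\<in>{1..r}. neg_support l e k \<subseteq> (\<lambda>\<sigma>. \<sigma> k) ` set s}" for e
    by (auto simp: covering_tuples_def)
  show ?thesis
  proof
    assume c: "c \<in> carrier (cech_cochains r l a (int n - 1))"
    have "has_degree r l a e \<and> s \<in> coord_tuples r l (neg_support l e) n"
      if "Poly_Mapping.lookup (c s) e \<noteq> 0" for e s
    proof -
      have s: "s \<in> coord_tuples r l (\<lambda>k. {}) n"
        using c that by (auto simp: cech_cochains_def chart_tuples_eq)
      then have "c s \<in> twist_sections r l a (inverted r s)"
        using c by (simp add: cech_cochains_def chart_tuples_eq)
      then show ?thesis
        using that s unfolding mem_twist_sections_iff cov by blast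
    qed
    then show "\<forall>e. ?P e"
      by (auto simp: cochains_def)
  next
    assume *: "\<forall>e. ?P e"
    have supp: "has_degree r l a e \<and> s \<in> coord_tuples r l (neg_support l e) n"
      if "Poly_Mapping.lookup (c s) e \<noteq> 0" for e s
      using *[rule_format, of e] that by (auto simp: cochains_def split: if_splits)
    have "c s = 0" if "s \<notin> coord_tuples r l (\<lambda>k. {}) n" for s
    proof (rule poly_mapping_eqI)
      show "Poly_Mapping.lookup (c s) e = Poly_Mapping.lookup 0 e" for e
        using supp[of s e] that unfolding cov lookup_zero by blast
    qed
    moreover have "c s \<in> twist_sections r l a (inverted r s)" for s
      using supp unfolding mem_twist_sections_iff cov by blast
    ultimately show "c \<in> carrier (cech_cochains r l a (int n - 1))"
      by (auto simp: cech_cochains_def chart_tuples_eq)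
  qed
qed

lemma lookup_minus_one_power_mult:
  fixes x :: "'k::field laurent"
  shows "Poly_Mapping.lookup ((- 1) ^ j * x) e = (- 1) ^ j * Poly_Mapping.lookup x e"
  by (induction j) auto

text \<open>Restrictions are inclusions, so taking a coefficient commutes with the
  differential.\<close>

lemma lookup_tuple_diff:
  fixes c :: "(nat \<Rightarrow> nat) list \<Rightarrow> 'k::field laurent"
  shows "Poly_Mapping.lookup (tuple_diff c s) e = tuple_diff (\<lambda>t. Poly_Mapping.lookup (c t) e) s"
  by (simp add: tuple_diff_def lookup_sum lookup_minus_one_power_mult)

lemma cech_diff_eq:
  "cech_diff r l (int n - 1) c =
    (\<lambda>s. if s \<in> coord_tuples r l (\<lambda>k. {}) (Suc n) then tuple_diff c s else 0)"
  by (simp add: cech_diff_def tuple_diff_def chart_tuples_Suc cong: if_cong)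

lemma cech_cochains_group: "group (cech_cochains r l a q :: (_ \<Rightarrow> 'k::field laurent) monoid)"
  (is "group ?C")
proof (rule groupI)
  note [simp] = cech_cochains_def
  fix x assume x: "x \<in> carrier ?C"
  have "(\<lambda>s. - x s) \<in> carrier ?C"
    using x by (auto simp: twist_sections_def)
  then show "\<exists>y\<in>carrier ?C. y \<otimes>\<^bsub>?C\<^esub> x = \<one>\<^bsub>?C\<^esub>"
    by (rule rev_bexI) simp
next
  fix x y assume "x \<in> carrier ?C" "y \<in> carrier ?C"
  then show "x \<otimes>\<^bsub>?C\<^esub> y \<in> carrier ?C"
    using keys_add by (fastforce simp: cech_cochains_def twist_sections_def)
qed (auto simp: cech_cochains_def twist_sections_def add.assoc)

lemma cech_diff_hom:
  "cech_diff r l (int n - 1) \<in>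
    hom (cech_cochains r l a (int n - 1)) (cech_cochains r l a (int n) :: (_ \<Rightarrow> 'k::field laurent) monoid)"
proof (rule homI)
  fix c d :: "(nat \<Rightarrow> nat) list \<Rightarrow> 'k laurent"
  show "cech_diff r l (int n - 1) (c \<otimes>\<^bsub>cech_cochains r l a (int n - 1)\<^esub> d) =
      cech_diff r l (int n - 1) c \<otimes>\<^bsub>cech_cochains r l a (int n)\<^esub> cech_diff r l (int n - 1) d"
    by (auto simp: cech_cochains_def cech_diff_eq tuple_diff_add)
next
  fix c :: "(nat \<Rightarrow> nat) list \<Rightarrow> 'k laurent"
  assume c: "c \<in> carrier (cech_cochains r l a (int n - 1))"
  have "cech_diff r l (int n - 1) c \<in> carrier (cech_cochains r l a (int (Suc n) - 1))"
    unfolding mem_cech_cochains_iff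
  proof
    fix e
    have ce: "if has_degree r l a e
      then (\<lambda>s. Poly_Mapping.lookup (c s) e) \<in> cochains {1..r} (\<lambda>k. {..l k}) (neg_support l e) n
      else \<forall>s. Poly_Mapping.lookup (c s) e = 0"
      using c unfolding mem_cech_cochains_iff by blast
    show "if has_degree r l a e
      then (\<lambda>s. Poly_Mapping.lookup (cech_diff r l (int n - 1) c s) e)
        \<in> cochains {1..r} (\<lambda>k. {..l k}) (neg_support l e) (Suc n)
      else \<forall>s. Poly_Mapping.lookup (cech_diff r l (int n - 1) c s) e = 0"
    proof (cases "has_degree r l a e")
      case True
      with ce have ce': "(\<lambda>s. Poly_Mapping.lookup (c s) e) \<in> cochains {1..r} (\<lambda>k. {..l k}) (neg_support l e) n"
        by simp
      have "Poly_Mapping.lookup (cech_diff r l (int n - 1) c s) e = 0"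
        if "s \<notin> coord_tuples r l (neg_support l e) (Suc n)" for s
        using that tuple_diff_not_covering[OF ce', of s]
        by (auto simp: cech_diff_eq lookup_tuple_diff covering_tuples_def)
      then show ?thesis
        using True by (simp add: cochains_def)
    next
      case False
      with ce show ?thesis
        by (simp add: cech_diff_eq lookup_tuple_diff tuple_diff_zero)
    qed
  qed
  then show "cech_diff r l (int n - 1) c \<in> carrier (cech_cochains r l a (int n))"
    by simp
qed

lemma cech_diff_cech_diff:
  "cech_diff r l (int (Suc n) - 1) (cech_diff r l (int n - 1) c) = (\<lambda>s. 0)"
proof
  fix s
  show "cech_diff r l (int (Suc n) - 1) (cech_diff r l (int n - 1) c) s = 0"
  proof (cases "s \<in> coord_tuples r l (\<lambda>k. {}) (Suc (Suc n))")
    case True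
    \<comment> \<open>Faces of \<open>s\<close> are nonempty tuples of charts, where the truncation
      in \<open>cech_diff\<close> has no effect.\<close>
    then have "tuple_diff (cech_diff r l (int n - 1) c) s = tuple_diff (tuple_diff c) s"
      unfolding cech_diff_eq by (intro tuple_diff_cong) (auto simp: covering_tuples_def)
    then show ?thesis
      unfolding cech_diff_eq[of r l "Suc n"] by (simp add: tuple_diff_tuple_diff)
  next
    case False
    then show ?thesis
      unfolding cech_diff_eq[of r l "Suc n"] by simp
  qed
qed

text \<open>The two Bott conditions on one factor: in the second case \<open>l k + 1\<close> integer
  exponents are all at most -1.\<close>

lemma neg_support_card:
  assumes e: "has_degree r l a e" and k: "k \<in> {1..r}"
  shows "neg_support l e k = {} \<Longrightarrow> 0 \<le> a k"
    and "neg_support l e k = {..l k} \<Longrightarrow> a k < - int (l k)"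
proof -
  have a: "a k = (\<Sum>i\<le>l k. Poly_Mapping.lookup e (k, i))"
    using e k by (simp add: has_degree_def)
  show "0 \<le> a k" if "neg_support l e k = {}"
    unfolding a using that by (intro sum_nonneg) (force simp: neg_support_def not_less)
  show "a k < - int (l k)" if "neg_support l e k = {..l k}"
  proof -
    have "a k \<le> (\<Sum>i\<le>l k. -1)"
      unfolding a using that by (intro sum_mono) (force simp: neg_support_def)
    then show ?thesis by simp
  qed
qed

text \<open>The assumption \<open>van\<close> excludes the exceptional degree at every exponent, so
  each coefficient of \<open>c\<close> has a primitive. Only finitely many exponents occur in
  \<open>c\<close>, so these primitives assemble to a cochain of Laurent polynomials.\<close>

lemma cocycle_is_coboundary:
  fixes c :: "(nat \<Rightarrow> nat) list \<Rightarrow> 'k::field laurent"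
  assumes van: "\<And>J. J \<subseteq> {1..r} \<Longrightarrow> \<forall>k\<in>J. a k < - int (l k) \<Longrightarrow> \<forall>k\<in>{1..r} - J. 0 \<le> a k \<Longrightarrow>
      q \<noteq> (\<Sum>k\<in>J. l k)"
    and c: "c \<in> carrier (cech_cochains r l a (int (Suc q) - 1))"
    and cyc: "cech_diff r l (int (Suc q) - 1) c = (\<lambda>s. 0)"
  shows "c \<in> cech_diff r l (int q - 1) ` carrier (cech_cochains r l a (int q - 1))"
proof -
  let ?A = "\<lambda>k. {..l k}"
  let ?T = "coord_tuples r l (\<lambda>k. {}) (Suc q)"
  have cov: "coord_tuples r l (neg_support l e) n \<subseteq> coord_tuples r l (\<lambda>k. {}) n" for e n
    by (auto simp: covering_tuples_def)
  have ce: "if has_degree r l a e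
      then (\<lambda>s. Poly_Mapping.lookup (c s) e) \<in> cochains {1..r} ?A (neg_support l e) (Suc q)
      else \<forall>s. Poly_Mapping.lookup (c s) e = 0" for e
    using c unfolding mem_cech_cochains_iff by blast
  have "\<exists>g \<in> cochains {1..r} ?A (neg_support l e) q. \<forall>s\<in>?T. Poly_Mapping.lookup (c s) e = tuple_diff g s"
    if e: "has_degree r l a e" for e
  proof -
    let ?N = "neg_support l e"
    have ce': "(\<lambda>s. Poly_Mapping.lookup (c s) e) \<in> cochains {1..r} ?A ?N (Suc q)"
      using ce[of e] e by simp
    moreover have "tuple_diff (\<lambda>s. Poly_Mapping.lookup (c s) e) s = 0"
      if "s \<in> coord_tuples r l ?N (Suc (Suc q))" for s
    proof -
      have "s \<in> coord_tuples r l (\<lambda>k. {}) (Suc (Suc q))"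
        using that cov by blast
      then have "tuple_diff c s = 0"
        using fun_cong[OF cyc, of s] by (simp only: cech_diff_eq if_True)
      then show ?thesis
        by (simp flip: lookup_tuple_diff)
    qed
    ultimately have "(\<lambda>s. Poly_Mapping.lookup (c s) e) \<in> cocycles {1..r} ?A ?N q"
      by (simp add: cocycles_def)
    moreover have "(cocycles {1..r} ?A ?N q :: (_ \<Rightarrow> 'k) set) \<subseteq> coboundaries {1..r} ?A ?N q"
    proof (rule cocycles_subset_coboundaries)
      show "\<not> ((\<forall>k\<in>{1..r}. ?N k = {} \<or> ?N k = ?A k) \<and>
          q = (\<Sum>k | k \<in> {1..r} \<and> ?N k \<noteq> {}. card (?A k) - 1))"
      proof
        assume *: "(\<forall>k\<in>{1..r}. ?N k = {} \<or> ?N k = ?A k) \<and>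
          q = (\<Sum>k | k \<in> {1..r} \<and> ?N k \<noteq> {}. card (?A k) - 1)"
        \<comment> \<open>Here \<open>J\<close> is the set of factors with nonempty, hence full,
          negative support.\<close>
        have "q \<noteq> (\<Sum>k | k \<in> {1..r} \<and> ?N k \<noteq> {}. l k)"
          using * neg_support_card[OF e] by (intro van) blast+
        with * show False by simp
      qed
    qed (auto simp: neg_support_def)
    ultimately obtain g where g: "g \<in> cochains {1..r} ?A ?N q"
      and cg: "\<And>s. s \<in> coord_tuples r l ?N (Suc q) \<Longrightarrow> Poly_Mapping.lookup (c s) e = tuple_diff g s"
      by (fastforce simp: coboundaries_def)
    \<comment> \<open>At chart tuples that do not cover the negative support both sides
      vanish.\<close>
    have "Poly_Mapping.lookup (c s) e = tuple_diff g s" if s: "s \<in> ?T" for s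
    proof (cases "s \<in> coord_tuples r l ?N (Suc q)")
      case False
      then have "\<not> (\<forall>k\<in>{1..r}. ?N k \<subseteq> (\<lambda>\<sigma>. \<sigma> k) ` set s)"
        using s by (auto simp: covering_tuples_def)
      from tuple_diff_not_covering[OF g this] False ce' show ?thesis
        by (simp add: cochains_def)
    qed (rule cg)
    with g show ?thesis by blast
  qed
  then obtain b where b: "\<And>e. has_degree r l a e \<Longrightarrow> b e \<in> cochains {1..r} ?A (neg_support l e) q"
    and cb: "\<And>e s. has_degree r l a e \<Longrightarrow> s \<in> ?T \<Longrightarrow> Poly_Mapping.lookup (c s) e = tuple_diff (b e) s"
    by metis
  \<comment> \<open>Restricting to the exponents that occur in \<open>c\<close> makes the sum
    defining \<open>g\<close> finite.\<close>
  define E where "E = (\<Union>s\<in>?T. Poly_Mapping.keys (c s))"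
  have "finite {s. set s \<subseteq> Pi\<^sub>E {1..r} ?A \<and> length s = Suc q}"
    by (intro finite_lists_length_eq finite_PiE) auto
  then have "finite ?T"
    by (rule rev_finite_subset) (auto simp: covering_tuples_def)
  then have E: "finite E"
    by (simp add: E_def)
  have E_deg: "has_degree r l a e" if "e \<in> E" for e
    using that ce[of e] by (auto simp: E_def in_keys_iff split: if_splits)
  define g where "g s = (\<Sum>e\<in>E. Poly_Mapping.single e (b e s))" for s
  have lookup_g: "Poly_Mapping.lookup (g s) e = (if e \<in> E then b e s else 0)" for s e
    using E by (simp add: g_def lookup_sum lookup_single when_def)
  have "g \<in> carrier (cech_cochains r l a (int q - 1))"
    unfolding mem_cech_cochains_iff
  proof
    fix e
    show "if has_degree r l a e
      then (\<lambda>s. Poly_Mapping.lookup (g s) e) \<in> cochains {1..r} ?A (neg_support l e) q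
      else \<forall>s. Poly_Mapping.lookup (g s) e = 0"
      using b[of e] E_deg[of e] by (auto simp: lookup_g cochains_def)
  qed
  moreover have "c = cech_diff r l (int q - 1) g"
  proof (intro ext poly_mapping_eqI)
    fix s e
    show "Poly_Mapping.lookup (c s) e = Poly_Mapping.lookup (cech_diff r l (int q - 1) g s) e"
    proof (cases "s \<in> ?T")
      case True
      have "Poly_Mapping.lookup (c s) e = tuple_diff (\<lambda>t. Poly_Mapping.lookup (g t) e) s"
      proof (cases "e \<in> E")
        case True
        then show ?thesis
          using cb[OF E_deg \<open>s \<in> ?T\<close>] by (simp add: lookup_g)
      next
        case False
        with \<open>s \<in> ?T\<close> show ?thesis
          by (simp add: lookup_g tuple_diff_zero E_def in_keys_iff)
      qed
      with True show ?thesis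
        by (simp add: cech_diff_eq lookup_tuple_diff)
    next
      case False
      then have "c s = 0"
        using c unfolding chart_tuples_eq cech_cochains_def by (simp add: chart_tuples_Suc)
      with False show ?thesis
        by (simp add: cech_diff_eq)
    qed
  qed
  ultimately show ?thesis by blast
qed

section \<open>From exactness to trivial cohomology groups\<close>

lemma (in group) trivial_group_Mod_self:
  assumes "subgroup H G"
  shows "trivial_group (G\<lparr>carrier := H\<rparr> Mod H)"
proof -
  interpret H: group "G\<lparr>carrier := H\<rparr>"
    using assms by (rule subgroup_imp_group)
  have "H \<lhd> G\<lparr>carrier := H\<rparr>"
    using H.normal_self by simp
  then have "group (G\<lparr>carrier := H\<rparr> Mod H)"
    by (rule normal.factorgroup_is_group)
  moreover have "carrier (G\<lparr>carrier := H\<rparr> Mod H) = {H}"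
    using H.coset_join2[OF _ H.subgroup_self] H.one_closed
    by (auto simp: FactGroup_def RCOSETS_def)
  ultimately show ?thesis
    by (simp add: group.trivial_group)
qed

text \<open>The assumption says that no Kuenneth summand allowed by Bott sits in degree
  \<open>q\<close>. For \<open>q \<ge> 0\<close> exactness makes the kernel equal to the image; for
  negative \<open>q\<close> there are no tuples.\<close>

lemma trivial_cohomology:
  assumes van: "\<And>J. J \<subseteq> {1..r} \<Longrightarrow> \<forall>k\<in>J. a k < - int (l k) \<Longrightarrow> \<forall>k\<in>{1..r} - J. 0 \<le> a k \<Longrightarrow>
      q \<noteq> (\<Sum>k\<in>J. int (l k))"
  shows "trivial_group (cohomology r l a q :: ((nat \<Rightarrow> nat) list \<Rightarrow> 'k::field laurent) set monoid)"
proof -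
  let ?C = "\<lambda>q. cech_cochains r l a q :: ((nat \<Rightarrow> nat) list \<Rightarrow> 'k laurent) monoid"
  let ?Z = "kernel (?C q) (?C (q + 1)) (cech_diff r l q)"
  have Z: "?Z = cech_diff r l (q - 1) ` carrier (?C (q - 1)) \<and> subgroup ?Z (?C q)"
  proof (cases "0 \<le> q")
    case True
    then obtain n where q: "q = int (Suc n) - 1"
      using nonneg_int_cases by fastforce
    have "n \<noteq> (\<Sum>k\<in>J. l k)"
      if "J \<subseteq> {1..r}" "\<forall>k\<in>J. a k < - int (l k)" "\<forall>k\<in>{1..r} - J. 0 \<le> a k" for J
      using van[OF that] q by auto
    note exact = cocycle_is_coboundary[OF this]
    have "?Z = cech_diff r l (q - 1) ` carrier (?C (q - 1))"
    proof
      show "?Z \<subseteq> cech_diff r l (q - 1) ` carrier (?C (q - 1))"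
        using exact by (auto simp: kernel_def cech_cochains_def q)
      show "cech_diff r l (q - 1) ` carrier (?C (q - 1)) \<subseteq> ?Z"
        using hom_in_carrier[OF cech_diff_hom[of r l n a]] cech_diff_cech_diff[of r l n]
        by (auto simp: kernel_def q cech_cochains_def)
    qed
    moreover have "group_hom (?C q) (?C (q + 1)) (cech_diff r l q)"
      using cech_diff_hom[of r l "Suc n" a] cech_cochains_group
      by (auto simp: group_hom_def group_hom_axioms_def q add.commute)
    then have "subgroup ?Z (?C q)"
      by (rule group_hom.subgroup_kernel)
    ultimately show ?thesis ..
  next
    case False
    then have none: "chart_tuples r l p = {}" if "p \<le> q" for p
      using that by (auto simp: chart_tuples_def simp flip: length_greater_0_conv)
    have zero: "carrier (?C p) = {\<lambda>s. 0}" if "p \<le> q" for p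
      using none[OF that] by (auto simp: cech_cochains_def)
    have diff: "cech_diff r l p (\<lambda>s. 0) = (\<lambda>s. 0 :: 'k laurent)" for p
      by (auto simp: cech_diff_def)
    have Z0: "?Z = {\<lambda>s. 0}"
      using zero[of q] diff by (auto simp: kernel_def cech_cochains_def)
    have "subgroup (carrier (?C q)) (?C q)"
      by (rule group.subgroup_self[OF cech_cochains_group])
    with Z0 zero[of q] zero[of "q - 1"] diff show ?thesis
      by simp
  qed
  then show ?thesis
    unfolding cohomology_def using group.trivial_group_Mod_self[OF cech_cochains_group, of ?Z] by metis
qed

lemma trivial_product_group:
  assumes "\<And>i. i \<in> I \<Longrightarrow> trivial_group (G i)"
  shows "trivial_group (product_group I G)"
  using assms by (auto simp: trivial_group_def PiE_eq_singleton)

section \<open>Numerical constraints on the contributing index sets\<close>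

lemma determinantal_index_set:
  fixes r :: nat and l d :: "nat \<Rightarrow> nat" and p :: int
  assumes d: "\<forall>k\<in>{1..r}. 0 < d k"
    and defect: "\<forall>k\<in>{1..r}. defect l d k \<le> 1"
    and inj: "inj_on \<pi> {1..r}"
    and m: "m = (\<lambda>k. (- defect l d k + (\<Sum>j \<in> {j \<in> {1..r}. \<pi> k \<le> (\<pi> j :: nat)}. int (l j))) * int (d k) - int (l k))"
    and l: "\<forall>k\<in>{1..r}. 0 < l k"
    and p: "0 \<le> p" "p \<le> (\<Sum>k=1..r. int (l k)) + 1"
    and J: "J \<subseteq> {1..r}" "\<forall>k\<in>J. m k - p * int (d k) < - int (l k)"
      "\<forall>k\<in>{1..r} - J. 0 \<le> m k - p * int (d k)"
  shows "p - (\<Sum>k\<in>J. int (l k)) \<in> {0, 1}"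
proof -
  \<comment> \<open>\<open>w k\<close> will be the total dimension of the factors placed by
    \<open>\<pi>\<close> at or above \<open>k\<close>.\<close>
  define S where "S k = {j \<in> {1..r}. \<pi> k \<le> \<pi> j}" for k
  define w where "w k = (\<Sum>j\<in>S k. int (l j))" for k
  have m_eq: "m k - p * int (d k) = (w k - defect l d k - p) * int (d k) - int (l k)" for k
    by (simp add: m w_def S_def algebra_simps)
  have finS: "finite (S k)" for k
    by (simp add: S_def)
  have inJ: "w k \<le> p" if "k \<in> J" for k
  proof -
    have k: "k \<in> {1..r}" using that J(1) by blast
    have "(w k - defect l d k - p) * int (d k) < 0"
      using J(2) that by (auto simp: m_eq)
    \<comment> \<open>By integrality \<open>p\<close> is at least
      \<open>w k - defect l d k + 1\<close>, and the defect is at most 1.\<close>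
    then have "w k - defect l d k - p < 0"
      by (simp add: mult_less_0_iff)
    moreover have "defect l d k \<le> 1" using defect k by blast
    ultimately show ?thesis by simp
  qed
  have notJ: "p \<le> w k - int (l k)" if k: "k \<in> {1..r} - J" for k
  proof -
    let ?x = "w k - defect l d k - p"
    have dk: "0 < d k" using d k by blast
    have "int (l k) \<le> ?x * int (d k)"
      using J(3) k by (fastforce simp: m_eq)
    then have "real (l k) \<le> of_int ?x * real (d k)"
      by (metis of_int_le_iff of_int_mult of_int_of_nat_eq)
    then have "real (l k) / real (d k) \<le> of_int ?x"
      using dk by (simp add: pos_divide_le_eq)
    then have "\<lceil>real (l k) / real (d k)\<rceil> \<le> ?x"
      by (rule ceiling_le)
    \<comment> \<open>The ceiling is \<open>l k - defect l d k\<close>, so the defect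
      cancels.\<close>
    then show ?thesis by (simp add: defect_def)
  qed
  have upclosed: "j \<in> J" if "k \<in> J" "j \<in> S k" for j k
  proof (rule ccontr)
    assume "j \<notin> J"
    with that have j: "j \<in> {1..r} - J" by (auto simp: S_def)
    have "S j \<subseteq> S k" using that by (auto simp: S_def)
    then have "w j \<le> w k"
      unfolding w_def using finS by (intro sum_mono2) auto
    moreover have "0 < int (l j)" using l j by auto
    ultimately show False
      using inJ[OF that(1)] notJ[OF j] by linarith
  qed
  have finJ: "finite J" using J(1) finite_subset by blast
  have lower: "(\<Sum>k\<in>J. int (l k)) \<le> p"
  proof (cases "J = {}")
    case False
    then obtain k where k: "k \<in> J" "\<And>j. j \<in> J \<Longrightarrow> \<pi> k \<le> \<pi> j"
      using ex_min_if_finite[of "\<pi> ` J"] finJ by (metis arg_min_least arg_min_if_finite(1))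
    \<comment> \<open>As \<open>k\<close> is lowest in \<open>J\<close>, all of \<open>J\<close>
      lies at or above \<open>k\<close>.\<close>
    then have "J \<subseteq> S k" using J(1) by (auto simp: S_def)
    then have "(\<Sum>k\<in>J. int (l k)) \<le> w k"
      unfolding w_def using finS by (intro sum_mono2) auto
    with inJ[OF k(1)] show ?thesis by simp
  qed (use p in simp)
  have upper: "p \<le> (\<Sum>k\<in>J. int (l k)) + 1"
  proof (cases "J = {1..r}")
    case False
    define B where "B = {1..r} - J"
    have B: "finite B" "B \<noteq> {}" using False J(1) by (auto simp: B_def)
    then have "Max (\<pi> ` B) \<in> \<pi> ` B" by (intro Max_in) auto
    then obtain k where k: "k \<in> B" "\<pi> k = Max (\<pi> ` B)" by auto
    \<comment> \<open>As \<open>k\<close> is highest outside \<open>J\<close>, everything above it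
      is in \<open>J\<close>. Injectivity of \<open>\<pi>\<close> excludes ties with
      \<open>k\<close>.\<close>
    have "j \<in> J" if j: "j \<in> S k - {k}" for j
    proof (rule ccontr)
      assume "j \<notin> J"
      with j have "j \<in> B" by (auto simp: S_def B_def)
      then have "\<pi> j \<le> \<pi> k" using B k by simp
      with j have "\<pi> j = \<pi> k" by (simp add: S_def)
      from inj_onD[OF inj this] have "j = k"
        using j k by (auto simp: S_def B_def)
      with j show False by simp
    qed
    then have "(\<Sum>j\<in>S k - {k}. int (l j)) \<le> (\<Sum>j\<in>J. int (l j))"
      using finJ by (intro sum_mono2) auto
    moreover have "k \<in> S k" using k by (auto simp: S_def B_def)
    then have "w k - int (l k) = (\<Sum>j\<in>S k - {k}. int (l j))"
      using finS by (simp add: w_def sum_diff1)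
    ultimately show ?thesis
      using notJ[of k] k by (simp add: B_def)
  \<comment> \<open>For full \<open>J\<close> only the length of the complex bounds
    \<open>p\<close>; this is where the extra 1 enters.\<close>
  qed (use p in simp)
  from lower upper show ?thesis by auto
qed

theorem theorem4p2:
  fixes r :: nat and l d :: "nat \<Rightarrow> nat" and \<pi> :: "nat \<Rightarrow> nat"
  assumes "1 \<le> r"
    and "\<forall>k \<in> {1..r}. 0 < l k"
    and "\<forall>k \<in> {1..r}. 0 < d k"
    and "\<forall>k \<in> {1..r}. 0 \<le> defect l d k \<and> defect l d k \<le> 1"
    and "\<pi> permutes {1..r}"
  shows "determinantal TYPE('k::{alg_closed_field, field_char_0}) r l d
    (\<lambda>k. (- defect l d k + (\<Sum>j \<in> {j \<in> {1..r}. \<pi> k \<le> \<pi> j}. int (l j))) * int (d k) - int (l k))"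
  unfolding determinantal_def weyman_term_def Let_def
proof (intro allI impI trivial_product_group)
  fix \<nu> :: int and x
  assume \<nu>: "\<nu> \<notin> {0, 1}"
    and x: "x \<in> (SIGMA p:{0..(\<Sum>k=1..r. l k) + 1}. {..<((\<Sum>k=1..r. l k) + 1) choose p})"
  define m where "m = (\<lambda>k. (- defect l d k + (\<Sum>j \<in> {j \<in> {1..r}. \<pi> k \<le> \<pi> j}. int (l j))) * int (d k) - int (l k))"
  obtain p i where x_eq: "x = (p, i)" by fastforce
  with x have "p \<le> (\<Sum>k=1..r. l k) + 1" by auto
  then have p: "int p \<le> (\<Sum>k=1..r. int (l k)) + 1" by (simp flip: of_nat_sum)
  have "trivial_group (cohomology r l (\<lambda>k. m k - int p * int (d k)) (int p - \<nu>) ::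
      ((nat \<Rightarrow> nat) list \<Rightarrow> 'k laurent) set monoid)"
  proof (rule trivial_cohomology)
    fix J
    assume "J \<subseteq> {1..r}" "\<forall>k\<in>J. m k - int p * int (d k) < - int (l k)"
      "\<forall>k\<in>{1..r} - J. 0 \<le> m k - int p * int (d k)"
    \<comment> \<open>A contributing \<open>J\<close> in degree \<open>p - \<nu>\<close> would make
      this difference equal to \<open>\<nu>\<close>.\<close>
    then have "int p - (\<Sum>k\<in>J. int (l k)) \<in> {0, 1}"
      using assms p by (intro determinantal_index_set[OF _ _ _ m_def]) (auto simp: permutes_inj_on)
    with \<nu> show "int p - \<nu> \<noteq> (\<Sum>k\<in>J. int (l k))" by auto
  qed
  then show "trivial_group ((case x of (p, i) \<Rightarrow> cohomology r l
      (\<lambda>k. (- defect l d k + (\<Sum>j \<in> {j \<in> {1..r}. \<pi> k \<le> \<pi> j}. int (l j))) * int (d k) - int (l k)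
        - int p * int (d k)) (int p - \<nu>)) :: ((nat \<Rightarrow> nat) list \<Rightarrow> 'k laurent) set monoid)"
    by (simp add: x_eq m_def)
qed

end
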